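(* Let $P$ be a finite definite logic program and let $S \subseteq \mathcal{TB}$. Assume that there exists a level mapping $|\ | : S \to \mathbb{N}$ such that for each $A \in S$ there exist a clause $C \in P$ and atoms $A_1,\dots,A_n$ with $\{A_1,\dots,A_n\} \subseteq S$, $A \in \mathbf{T}^\pi_{\{C\}}(\{A_1,\dots,A_n\})$, and $|A| > |A_i|$ for $i=1,\dots,n$. Then $S \subseteq \mathcal{O}(P)$.
   Context: Definite clause logic programs over a fixed alphabet; $\mathcal{TB}$ denotes the set of all (not necessarily ground) atoms over the alphabet, $\mathbb{N}$ the natural numbers. The s-semantics of $P$ is the set $\mathcal{O}(P)$ of all atoms $A$ such that $A = p(V_1,\dots,V_n)\theta$, where $p$ is an $n$-ary predicate symbol, $V_1,\dots,V_n$ are distinct variables, and $\theta$ is an SLD-computed answer substitution for the query $p(V_1,\dots,V_n)$ in $P$. For a program $Q$, the operator $\mathbf{T}^\pi_Q : 2^{\mathcal{TB}} \to 2^{\mathcal{TB}}$ is defined by: $\mathbf{T}^\pi_Q(I)$ is the set of all atoms $H\theta$ such that there are a clause $(H \gets B_1,\dots,B_m) \in Q$ and atoms $A_1,\dots,A_m \in I$ with $A_1,\dots,A_m,(H\gets B_1,\dots,B_m)$ pairwise variable disjoint and $\theta$ an mgu of $(B_1,\dots,B_m)$ and $(A_1,\dots,A_m)$; $\mathbf{T}^\pi_{\{C\}}$ is this operator for the one-clause program $\{C\}$. A level mapping on $S$ is a function $|\ | : S \to \mathbb{N}$ such that whenever $A,A' \in S$ are variants of each other, $|A| = |A'|$.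 A program is complete w.r.t. $S$ when $S\subseteq\mathcal{O}(P)$. *)

theory Defs
  imports Main "HOL-Library.Infinite_Typeclass"
begin

text \<open>
  An alphabet is given by a set \<open>F\<close> of function symbols and a set \<open>Q\<close> of predicate symbols;
  a symbol is a name together with an arity, so that names may be used with several arities.
  The variables are the elements of an infinite type.
\<close>

datatype (funs_trm: 'f, vars_trm: 'v) trm =
  Var 'v | Fun 'f "('f, 'v) trm list"

datatype (preds_atm: 'p, funs_atm: 'f, vars_atm: 'v) atm =
  Atm 'p "('f, 'v) trm list"

datatype (preds_clause: 'p, funs_clause: 'f, vars_clause: 'v) clause =
  Clause (head: "('p, 'f, 'v) atm") (body: "('p, 'f, 'v) atm list")

type_synonym ('p, 'f, 'v) query = "('p, 'f, 'v) atm list"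

inductive_set trms :: "('f \<times> nat) set \<Rightarrow> ('f, 'v) trm set" for F where
  "Var x \<in> trms F"
| "(f, length ts) \<in> F \<Longrightarrow> \<forall>t\<in>set ts. t \<in> trms F \<Longrightarrow> Fun f ts \<in> trms F"

text \<open>All atoms over the alphabet, ground or not.\<close>

definition TB :: "('f \<times> nat) set \<Rightarrow> ('p \<times> nat) set \<Rightarrow> ('p, 'f, 'v) atm set" where
  "TB F Q = {Atm p ts | p ts. (p, length ts) \<in> Q \<and> set ts \<subseteq> trms F}"

definition clauses :: "('f \<times> nat) set \<Rightarrow> ('p \<times> nat) set \<Rightarrow> ('p, 'f, 'v) clause set" where
  "clauses F Q = {C. head C \<in> TB F Q \<and> set (body C) \<subseteq> TB F Q}"

definition vars_query :: "('p, 'f, 'v) query \<Rightarrow> 'v set" where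
  "vars_query As = (\<Union>A\<in>set As. vars_atm A)"


type_synonym ('f, 'v) subst = "'v \<Rightarrow> ('f, 'v) trm"

definition subst_dom :: "('f, 'v) subst \<Rightarrow> 'v set" where
  "subst_dom \<sigma> = {x. \<sigma> x \<noteq> Var x}"

definition vars_subst :: "('f, 'v) subst \<Rightarrow> 'v set" where
  "vars_subst \<sigma> = subst_dom \<sigma> \<union> (\<Union>x\<in>subst_dom \<sigma>. vars_trm (\<sigma> x))"

definition substs :: "('f \<times> nat) set \<Rightarrow> ('f, 'v) subst set" where
  "substs F = {\<sigma>. finite (subst_dom \<sigma>) \<and> range \<sigma> \<subseteq> trms F}"

primrec subst_trm :: "('f, 'v) subst \<Rightarrow> ('f, 'v) trm \<Rightarrow> ('f, 'v) trm" where
  "subst_trm \<sigma> (Var x) = \<sigma> x"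
| "subst_trm \<sigma> (Fun f ts) = Fun f (map (subst_trm \<sigma>) ts)"

primrec subst_atm :: "('f, 'v) subst \<Rightarrow> ('p, 'f, 'v) atm \<Rightarrow> ('p, 'f, 'v) atm" where
  "subst_atm \<sigma> (Atm p ts) = Atm p (map (subst_trm \<sigma>) ts)"

primrec subst_clause :: "('f, 'v) subst \<Rightarrow> ('p, 'f, 'v) clause \<Rightarrow> ('p, 'f, 'v) clause" where
  "subst_clause \<sigma> (Clause H Bs) = Clause (subst_atm \<sigma> H) (map (subst_atm \<sigma>) Bs)"

text \<open>Composition in diagrammatic order: first \<open>\<sigma>\<close>, then \<open>\<tau>\<close>.\<close>

definition subst_comp :: "('f, 'v) subst \<Rightarrow> ('f, 'v) subst \<Rightarrow> ('f, 'v) subst" where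
  "subst_comp \<sigma> \<tau> = (\<lambda>x. subst_trm \<tau> (\<sigma> x))"

definition subst_restrict :: "'v set \<Rightarrow> ('f, 'v) subst \<Rightarrow> ('f, 'v) subst" where
  "subst_restrict X \<sigma> = (\<lambda>x. if x \<in> X then \<sigma> x else Var x)"

definition renaming :: "('f, 'v) subst \<Rightarrow> bool" where
  "renaming \<rho> \<longleftrightarrow> (\<exists>\<pi>. bij \<pi> \<and> finite {x. \<pi> x \<noteq> x} \<and> \<rho> = (\<lambda>x. Var (\<pi> x)))"

definition variant_atm :: "('p, 'f, 'v) atm \<Rightarrow> ('p, 'f, 'v) atm \<Rightarrow> bool" where
  "variant_atm A A' \<longleftrightarrow> (\<exists>\<rho>. renaming \<rho> \<and> A' = subst_atm \<rho> A)"

definition variant_clause :: "('p, 'f, 'v) clause \<Rightarrow> ('p, 'f, 'v) clause \<Rightarrow> bool" where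
  "variant_clause C C' \<longleftrightarrow> (\<exists>\<rho>. renaming \<rho> \<and> C' = subst_clause \<rho> C)"

text \<open>Unifiers of two sequences of atoms. An mgu is neither required to be idempotent nor to
  be relevant.\<close>

definition unifiers ::
  "('f \<times> nat) set \<Rightarrow> ('p, 'f, 'v) atm list \<Rightarrow> ('p, 'f, 'v) atm list \<Rightarrow> ('f, 'v) subst set" where
  "unifiers F As Bs = {\<sigma> \<in> substs F. map (subst_atm \<sigma>) As = map (subst_atm \<sigma>) Bs}"

definition mgu ::
  "('f \<times> nat) set \<Rightarrow> ('f, 'v) subst \<Rightarrow> ('p, 'f, 'v) atm list \<Rightarrow> ('p, 'f, 'v) atm list \<Rightarrow> bool" where
  "mgu F \<theta> As Bs \<longleftrightarrow> \<theta> \<in> unifiers F As Bs \<and>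
     (\<forall>\<tau>\<in>unifiers F As Bs. \<exists>\<delta>\<in>substs F. \<tau> = subst_comp \<theta> \<delta>)"


text \<open>
  \<open>sld_derivation F P Q0 ds G\<close>: there is a finite SLD-derivation from \<open>Q0\<close> to \<open>G\<close>, where \<open>ds\<close>
  lists the input clauses and mgus of its steps in order. An arbitrary atom of the query may be
  selected. Standardization apart: an input clause shares no variable with the initial query, the
  previous input clauses and the previous mgus (and hence none with the current query).
\<close>

inductive sld_derivation ::
  "('f \<times> nat) set \<Rightarrow> ('p, 'f, 'v) clause set \<Rightarrow> ('p, 'f, 'v) query \<Rightarrow>
   (('p, 'f, 'v) clause \<times> ('f, 'v) subst) list \<Rightarrow> ('p, 'f, 'v) query \<Rightarrow> bool"
  for F P Q0 where
  start: "sld_derivation F P Q0 [] Q0"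
| step: "\<lbrakk>sld_derivation F P Q0 ds (As @ A # As');
      C \<in> P; variant_clause C C';
      vars_clause C' \<inter>
        (vars_query Q0 \<union> (\<Union>(D, \<sigma>)\<in>set ds. vars_clause D \<union> vars_subst \<sigma>)) = {};
      mgu F \<theta> [A] [head C']\<rbrakk>
    \<Longrightarrow> sld_derivation F P Q0 (ds @ [(C', \<theta>)])
          (map (subst_atm \<theta>) (As @ body C' @ As'))"

definition computed_answer ::
  "('f \<times> nat) set \<Rightarrow> ('p, 'f, 'v) clause set \<Rightarrow> ('p, 'f, 'v) query \<Rightarrow> ('f, 'v) subst \<Rightarrow> bool" where
  "computed_answer F P Q0 \<theta> \<longleftrightarrow>
     (\<exists>ds. sld_derivation F P Q0 ds [] \<and>
       \<theta> = subst_restrict (vars_query Q0) (foldr subst_comp (map snd ds) Var))"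

definition s_semantics ::
  "('f \<times> nat) set \<Rightarrow> ('p \<times> nat) set \<Rightarrow> ('p, 'f, 'v) clause set \<Rightarrow> ('p, 'f, 'v) atm set" where
  "s_semantics F Q P = {subst_atm \<theta> (Atm p (map Var Vs)) | p Vs \<theta>.
     (p, length Vs) \<in> Q \<and> distinct Vs \<and> computed_answer F P [Atm p (map Var Vs)] \<theta>}"

text \<open>The clause is taken from \<open>P\<close> as it stands and the atoms from \<open>I\<close> as they stand, with no
  implicit renaming. Disjointness is by index, so a ground atom may be used repeatedly.\<close>

definition T_pi ::
  "('f \<times> nat) set \<Rightarrow> ('p, 'f, 'v) clause set \<Rightarrow> ('p, 'f, 'v) atm set \<Rightarrow> ('p, 'f, 'v) atm set" where
  "T_pi F P I = {subst_atm \<theta> (head C) | C As \<theta>.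
     C \<in> P \<and> set As \<subseteq> I \<and> length As = length (body C) \<and>
     (\<forall>i < length As. vars_atm (As ! i) \<inter> vars_clause C = {}) \<and>
     (\<forall>i < length As. \<forall>j < length As. i \<noteq> j \<longrightarrow> vars_atm (As ! i) \<inter> vars_atm (As ! j) = {}) \<and>
     mgu F \<theta> (body C) As}"

text \<open>Only the values of the function on \<open>S\<close> matter.\<close>

definition level_mapping :: "('p, 'f, 'v) atm set \<Rightarrow> (('p, 'f, 'v) atm \<Rightarrow> nat) \<Rightarrow> bool" where
  "level_mapping S lev \<longleftrightarrow> (\<forall>A\<in>S. \<forall>A'\<in>S. variant_atm A A' \<longrightarrow> lev A = lev A')"

end

(* By induction on the level, every A in S behaves like a fact of the program: whenever some
   instance of the selected atom B is an instance of A, the query can be continued so that B is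
   refuted, and the mgus of the continuation compose to a most general substitution turning B into
   an instance of A. For B = p(V1,...,Vn) the answer and A are then instances of each other, hence
   variants, and a renaming absorbed into the last mgu makes them equal. *)

theory Submission
  imports Defs
begin

section \<open>Terms and substitutions\<close>

text \<open>The atoms supplied by \<open>T_pi\<close> are taken as they stand, so they may share
  variables with the query, with earlier input clauses and with earlier mgus; and \<open>S\<close>
  need not be closed under renaming. For this reason the invariant speaks of instances:
  "\<open>subst_atm \<tau> B\<close> is an instance of \<open>A\<close>" expresses what unifying
  \<open>B\<close> with a variant of \<open>A\<close> renamed apart would, without choosing that
  variant. The disjointness built into \<open>T_pi\<close> enters only in
  \<open>glue_unifier\<close>, where separate matchers are merged into one unifier. The second
  obstacle is standardization apart in the presence of mgus that need not be relevant. An input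
  clause has to avoid the whole history, so the induction hypothesis must concern the continuation
  of an arbitrary derivation. Generality is claimed only on the variables of that history, since
  nothing prescribes values for variables introduced later. Such relative generality composes
  because old variables are mapped to terms over the enlarged history.\<close>

lemma subst_trm_eq_iff: "subst_trm \<sigma> t = subst_trm \<tau> t \<longleftrightarrow> (\<forall>x\<in>vars_trm t. \<sigma> x = \<tau> x)"
  by (induction t) auto

lemma subst_atm_eq_iff: "subst_atm \<sigma> A = subst_atm \<tau> A \<longleftrightarrow> (\<forall>x\<in>vars_atm A. \<sigma> x = \<tau> x)"
  by (cases A) (auto simp: subst_trm_eq_iff)

lemma subst_trm_Var [simp]: "subst_trm Var t = t"
  by (induction t) (auto simp: map_idI)

lemma subst_atm_Var [simp]: "subst_atm Var A = A"
  by (cases A) (auto simp: map_idI)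

lemma subst_trm_comp [simp]: "subst_trm (subst_comp \<sigma> \<tau>) t = subst_trm \<tau> (subst_trm \<sigma> t)"
  by (induction t) (auto simp: subst_comp_def)

lemma subst_atm_comp [simp]: "subst_atm (subst_comp \<sigma> \<tau>) A = subst_atm \<tau> (subst_atm \<sigma> A)"
  by (cases A) auto

lemma map_subst_atm_comp [simp]:
  "map (subst_atm (subst_comp \<sigma> \<tau>)) As = map (subst_atm \<tau>) (map (subst_atm \<sigma>) As)"
  by simp

lemma subst_comp_Var [simp]: "subst_comp Var \<sigma> = \<sigma>" "subst_comp \<sigma> Var = \<sigma>"
  by (auto simp: subst_comp_def)

lemma subst_comp_assoc: "subst_comp (subst_comp \<sigma> \<tau>) \<upsilon> = subst_comp \<sigma> (subst_comp \<tau> \<upsilon>)"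
  by (simp add: subst_comp_def flip: subst_trm_comp)

lemma vars_subst_trm: "vars_trm (subst_trm \<sigma> t) = (\<Union>x\<in>vars_trm t. vars_trm (\<sigma> x))"
  by (induction t) auto

lemma vars_subst_atm: "vars_atm (subst_atm \<sigma> A) = (\<Union>x\<in>vars_atm A. vars_trm (\<sigma> x))"
  by (cases A) (auto simp: vars_subst_trm)

lemma finite_vars_trm [simp]: "finite (vars_trm t)"
  by (induction t) auto

lemma finite_vars_atm [simp]: "finite (vars_atm A)"
  by (cases A) auto

lemma vars_clause_conv: "vars_clause C = vars_atm (head C) \<union> vars_query (body C)"
  by (cases C) (auto simp: vars_query_def)

lemma finite_vars_query [simp]: "finite (vars_query G)"
  by (simp add: vars_query_def)

lemma finite_vars_clause [simp]: "finite (vars_clause C)"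
  by (simp add: vars_clause_conv)

lemma head_subst_clause [simp]: "head (subst_clause \<sigma> C) = subst_atm \<sigma> (head C)"
  and body_subst_clause [simp]: "body (subst_clause \<sigma> C) = map (subst_atm \<sigma>) (body C)"
  by (cases C; simp)+

lemma vars_trm_subst_app: "vars_trm (\<sigma> x) \<subseteq> insert x (vars_subst \<sigma>)"
  by (cases "\<sigma> x = Var x") (auto simp: vars_subst_def subst_dom_def)

lemma finite_vars_subst: "\<sigma> \<in> substs F \<Longrightarrow> finite (vars_subst \<sigma>)"
  by (auto simp: substs_def vars_subst_def)

lemma trms_subst: "t \<in> trms F \<Longrightarrow> range \<sigma> \<subseteq> trms F \<Longrightarrow> subst_trm \<sigma> t \<in> trms F"
  by (induction rule: trms.induct) (auto intro!: trms.intros(2)[of _ "map _ _", simplified])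

lemma Fun_in_trms: "Fun f ts \<in> trms F \<longleftrightarrow> (f, length ts) \<in> F \<and> set ts \<subseteq> trms F"
  by (auto intro: trms.intros elim: trms.cases)

lemma substsD: "\<sigma> \<in> substs F \<Longrightarrow> \<sigma> x \<in> trms F"
  by (auto simp: substs_def)

lemma TB_subst: "A \<in> TB F Q \<Longrightarrow> \<sigma> \<in> substs F \<Longrightarrow> subst_atm \<sigma> A \<in> TB F Q"
  by (fastforce simp: TB_def substs_def intro: trms_subst)

lemma substs_Var [simp]: "Var \<in> substs F"
  by (auto simp: substs_def subst_dom_def intro: trms.intros)

lemma substs_comp:
  assumes "\<sigma> \<in> substs F" "\<tau> \<in> substs F"
  shows "subst_comp \<sigma> \<tau> \<in> substs F"
proof -
  have "subst_dom (subst_comp \<sigma> \<tau>) \<subseteq> subst_dom \<sigma> \<union> subst_dom \<tau>"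
    by (auto simp: subst_dom_def subst_comp_def)
  then have "finite (subst_dom (subst_comp \<sigma> \<tau>))"
    using assms finite_subset by (fastforce simp: substs_def)
  moreover have "subst_comp \<sigma> \<tau> x \<in> trms F" for x
    using assms by (auto simp: subst_comp_def substs_def intro: trms_subst)
  ultimately show ?thesis
    by (auto simp: substs_def)
qed

lemma substs_finite_supportI:
  assumes "finite X" "\<And>x. x \<in> X \<Longrightarrow> \<sigma> x \<in> trms F" "\<And>x. x \<notin> X \<Longrightarrow> \<sigma> x = Var x"
  shows "\<sigma> \<in> substs F"
proof -
  have "subst_dom \<sigma> \<subseteq> X"
    using assms(3) by (auto simp: subst_dom_def)
  moreover have "\<sigma> x \<in> trms F" for x
    by (cases "x \<in> X") (auto simp: assms(2,3) trms.intros)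
  ultimately show ?thesis
    using assms(1) by (auto simp: substs_def intro: finite_subset)
qed

section \<open>Renamings\<close>

text \<open>For finite \<open>X\<close> the sets \<open>f\<close> X - X\<open>and\<close>X - f
  \<open>X\<close> have equal size, so a bijection \<open>g\<close> can send the new points back to
  the abandoned ones. All other points stay fixed, which gives the finite support that
  \<open>renaming\<close> asks for.\<close>

lemma inj_on_extends_to_bij:
  assumes "finite X" "inj_on f X"
  obtains \<pi> where "bij \<pi>" "finite {x. \<pi> x \<noteq> x}" "\<And>x. x \<in> X \<Longrightarrow> \<pi> x = f x"
proof -
  have "card (f ` X - X) = card (X - f ` X)"
    using assms by (simp add: card_Diff_subset_Int card_image Int_commute)
  then obtain g where g: "bij_betw g (f ` X - X) (X - f ` X)"
    using assms(1) by (metis finite_Diff finite_imageI finite_same_card_bij)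
  define \<pi> where "\<pi> x = (if x \<in> X then f x else if x \<in> f ` X then g x else x)" for x
  have 1: "bij_betw \<pi> X (f ` X)"
    using assms(2) by (auto simp: bij_betw_def \<pi>_def inj_on_def)
  have 2: "bij_betw \<pi> (f ` X - X) (X - f ` X)"
    using g by (rule bij_betw_cong[THEN iffD1, rotated]) (auto simp: \<pi>_def)
  have 3: "bij_betw \<pi> (- (X \<union> f ` X)) (- (X \<union> f ` X))"
    by (auto simp: bij_betw_def \<pi>_def inj_on_def)
  have 12: "bij_betw \<pi> (X \<union> (f ` X - X)) (f ` X \<union> (X - f ` X))"
    by (rule bij_betw_combine[OF 1 2]) auto
  have "bij_betw \<pi> ((X \<union> (f ` X - X)) \<union> - (X \<union> f ` X)) ((f ` X \<union> (X - f ` X)) \<union> - (X \<union> f ` X))"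
    by (rule bij_betw_combine[OF 12 3]) auto
  moreover have "(X \<union> (f ` X - X)) \<union> - (X \<union> f ` X) = UNIV" "(f ` X \<union> (X - f ` X)) \<union> - (X \<union> f ` X) = UNIV"
    by auto
  ultimately have "bij \<pi>"
    by simp
  moreover have "{x. \<pi> x \<noteq> x} \<subseteq> X \<union> f ` X"
    by (auto simp: \<pi>_def)
  then have "finite {x. \<pi> x \<noteq> x}"
    using assms(1) by (meson finite_Un finite_imageI finite_subset)
  ultimately show thesis
    using that by (auto simp: \<pi>_def)
qed

text \<open>An injection of \<open>X\<close> into the infinite complement of \<open>W\<close> is not
  yet a renaming, which must permute all variables; the extension lemma repairs this.\<close>

lemma fresh_renaming:
  fixes X W :: "'v::infinite set"
  assumes "finite X" "finite W"
  obtains \<pi> where "bij \<pi>" "finite {x. \<pi> x \<noteq> x}" "\<pi> ` X \<inter> W = {}"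
proof -
  have "infinite (UNIV - W)"
    using assms(2) infinite_UNIV by (metis Diff_infinite_finite)
  then obtain Y where Y: "finite Y" "card Y = card X" "Y \<subseteq> UNIV - W"
    using infinite_arbitrarily_large by metis
  then obtain f where f: "bij_betw f X Y"
    using assms(1) by (metis finite_same_card_bij)
  obtain \<pi> where \<pi>: "bij \<pi>" "finite {x. \<pi> x \<noteq> x}" "\<And>x. x \<in> X \<Longrightarrow> \<pi> x = f x"
    using inj_on_extends_to_bij[OF assms(1) bij_betw_imp_inj_on[OF f]] by blast
  have "\<pi> ` X = Y"
    using f \<pi>(3) by (auto simp: bij_betw_def)
  then show thesis
    using that \<pi>(1,2) Y(3) by blast
qed

lemma renaming_in_substs: "renaming \<rho> \<Longrightarrow> \<rho> \<in> substs F"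
  by (auto simp: renaming_def substs_def subst_dom_def intro: trms.intros)

lemma renaming_inverse:
  assumes "renaming \<rho>"
  obtains \<rho>' where "renaming \<rho>'" "subst_comp \<rho> \<rho>' = Var"
proof -
  obtain \<pi> where \<pi>: "bij \<pi>" "finite {x. \<pi> x \<noteq> x}" "\<rho> = (\<lambda>x. Var (\<pi> x))"
    using assms by (auto simp: renaming_def)
  have "{x. inv \<pi> x \<noteq> x} = {x. \<pi> x \<noteq> x}"
    using \<pi>(1) by (metis bij_inv_eq_iff)
  then have "renaming (\<lambda>x. Var (inv \<pi> x))"
    using \<pi>(1,2) bij_imp_bij_inv[of \<pi>] unfolding renaming_def by (intro exI[of _ "inv \<pi>"]) simp
  moreover have "subst_comp \<rho> (\<lambda>x. Var (inv \<pi> x)) = Var"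
    using \<pi>(1) by (auto simp: subst_comp_def \<pi>(3) bij_is_inj)
  ultimately show thesis
    using that by blast
qed

text \<open>Applying \<open>\<delta>\<close> and then \<open>\<gamma>\<close> fixes every variable
  of \<open>A0\<close>. So \<open>\<delta>\<close> sends these variables to variables, as no
  substitution turns a compound term into a variable, and it does so injectively. Elsewhere
  \<open>\<delta>\<close> may be arbitrary, hence only its values on \<open>A0\<close> are kept and
  extended to a permutation.\<close>

lemma mutual_instances_renaming:
  assumes A: "subst_atm \<delta> A0 = A" and A0: "subst_atm \<gamma> A = A0"
  obtains \<rho> where "renaming \<rho>" "subst_atm \<rho> A0 = A"
proof -
  have "subst_atm (subst_comp \<delta> \<gamma>) A0 = subst_atm Var A0"
    using assms by simp
  then have inv: "subst_trm \<gamma> (\<delta> x) = Var x" if "x \<in> vars_atm A0" for x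
    using that unfolding subst_atm_eq_iff by (simp add: subst_comp_def)
  then have "\<exists>y. \<delta> x = Var y" if "x \<in> vars_atm A0" for x
    using that by (cases "\<delta> x") force+
  then obtain f where f: "\<And>x. x \<in> vars_atm A0 \<Longrightarrow> \<delta> x = Var (f x)"
    by metis
  have "inj_on f (vars_atm A0)"
    by (rule inj_onI) (metis f inv trm.inject(1))
  then obtain \<pi> where \<pi>: "bij \<pi>" "finite {x. \<pi> x \<noteq> x}" "\<And>x. x \<in> vars_atm A0 \<Longrightarrow> \<pi> x = f x"
    by (metis inj_on_extends_to_bij finite_vars_atm)
  have "subst_atm (\<lambda>x. Var (\<pi> x)) A0 = A"
    unfolding A[symmetric] subst_atm_eq_iff using f \<pi>(3) by simp
  then show thesis
    using that \<pi>(1,2) by (auto simp: renaming_def)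
qed

section \<open>Unification\<close>

definition solves_eqs :: "('f, 'v) subst \<Rightarrow> (('f, 'v) trm \<times> ('f, 'v) trm) list \<Rightarrow> bool" where
  "solves_eqs \<sigma> E \<longleftrightarrow> (\<forall>(s, t)\<in>set E. subst_trm \<sigma> s = subst_trm \<sigma> t)"

definition vars_eqs :: "(('f, 'v) trm \<times> ('f, 'v) trm) list \<Rightarrow> 'v set" where
  "vars_eqs E = (\<Union>(s, t)\<in>set E. vars_trm s \<union> vars_trm t)"

lemma finite_vars_eqs [simp]: "finite (vars_eqs E)"
  by (auto simp: vars_eqs_def)

lemma size_subst_ge: "x \<in> vars_trm t \<Longrightarrow> size (\<sigma> x) \<le> size (subst_trm \<sigma> t)"
proof (induction t)
  case (Fun f ts)
  then obtain t where t: "t \<in> set ts" "x \<in> vars_trm t" by auto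
  then have "size (\<sigma> x) \<le> size (subst_trm \<sigma> t)" using Fun by blast
  also have "\<dots> \<le> size_list size (map (subst_trm \<sigma>) ts)"
    using t by (intro size_list_estimation') auto
  finally show ?case by simp
qed simp

text \<open>If \<open>x\<close> lay properly inside \<open>t\<close>, then \<open>\<sigma> x\<close>
  would be larger than itself.\<close>

lemma occurs_check:
  assumes "subst_trm \<sigma> (Var x) = subst_trm \<sigma> t" "x \<in> vars_trm t"
  shows "t = Var x"
proof (cases t)
  case (Fun f ts)
  then obtain s where s: "s \<in> set ts" "x \<in> vars_trm s" using assms by auto
  then have "size (\<sigma> x) \<le> size (subst_trm \<sigma> s)" using size_subst_ge by metis
  also have "\<dots> \<le> size_list size (map (subst_trm \<sigma>) ts)"
    using s by (intro size_list_estimation') auto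
  finally show ?thesis using assms(1) Fun by simp
qed (use assms in auto)

text \<open>The idempotent form of generality, \<open>\<tau> = \<theta>\<tau>\<close>, is what makes the induction go through.\<close>

lemma idempotent_mgu_eqs:
  assumes "solves_eqs \<tau> E" "\<forall>(s, t)\<in>set E. s \<in> trms F \<and> t \<in> trms F"
  shows "\<exists>\<theta>\<in>substs F. solves_eqs \<theta> E \<and> (\<forall>\<tau>. solves_eqs \<tau> E \<longrightarrow> \<tau> = subst_comp \<theta> \<tau>)"
    (is "\<exists>\<theta>\<in>_. ?mgu \<theta> E")
  using assms
\<comment> \<open>Lexicographic order: eliminating a variable may enlarge the terms but leaves fewer
  variables; decomposing and deleting a trivial equation add no variables and lower the total
  size.\<close>
proof (induction E rule: wf_induct_rule[OF wf_measures[of "[\<lambda>E. card (vars_eqs E),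
      \<lambda>E. \<Sum>(s, t)\<leftarrow>E. size s + size t]"]])
  case (1 E)
  have eliminate: "\<exists>\<theta>\<in>substs F. ?mgu \<theta> E"
    if E: "E = (u, v) # E'" and uv: "(u, v) = (Var x, t) \<or> (u, v) = (t, Var x)"
      and x: "x \<notin> vars_trm t" for x t u v E'
  proof -
    define \<sigma> where "\<sigma> = Var(x := t)"
    define E'' where "E'' = map (map_prod (subst_trm \<sigma>) (subst_trm \<sigma>)) E'"
    have t: "t \<in> trms F" using "1.prems"(2) E uv by auto
    have \<sigma>: "\<sigma> \<in> substs F"
      by (rule substs_finite_supportI[of "{x}"]) (auto simp: \<sigma>_def t)
    \<comment> \<open>A solution of the equation between \<open>x\<close> and \<open>t\<close>
      already absorbs \<open>\<sigma>\<close>. This transfers solutions of \<open>E\<close> to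
      \<open>E''\<close> unchanged and preserves the idempotent form of generality.\<close>
    have absorb: "subst_comp \<sigma> \<upsilon> = \<upsilon>" if "\<upsilon> x = subst_trm \<upsilon> t" for \<upsilon>
      using that by (auto simp: subst_comp_def \<sigma>_def)
    have solves_E'': "solves_eqs \<upsilon> E'' \<longleftrightarrow> solves_eqs (subst_comp \<sigma> \<upsilon>) E'" for \<upsilon>
      by (auto simp: solves_eqs_def E''_def)
    have solves_E: "solves_eqs \<upsilon> E \<longleftrightarrow> \<upsilon> x = subst_trm \<upsilon> t \<and> solves_eqs \<upsilon> E'" for \<upsilon>
      using uv by (auto simp: solves_eqs_def E)
    have vars_\<sigma>: "vars_trm (subst_trm \<sigma> s) \<subseteq> vars_trm s \<union> vars_trm t - {x}" for s
      using x by (auto simp: vars_subst_trm \<sigma>_def split: if_splits)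
    have "vars_eqs E'' \<subseteq> vars_eqs E - {x}"
      using vars_\<sigma> uv by (fastforce simp: vars_eqs_def E''_def E)
    moreover have "x \<in> vars_eqs E"
      using uv by (auto simp: vars_eqs_def E)
    ultimately have "card (vars_eqs E'') < card (vars_eqs E)"
      by (intro psubset_card_mono) auto
    moreover have "\<forall>(s, t)\<in>set E''. s \<in> trms F \<and> t \<in> trms F"
      using "1.prems"(2) \<sigma> by (auto simp: E''_def E substs_def intro!: trms_subst)
    moreover have "solves_eqs \<tau> E''"
      using "1.prems"(1) by (auto simp: solves_E'' solves_E absorb)
    ultimately obtain \<theta> where \<theta>: "\<theta> \<in> substs F" "?mgu \<theta> E''"
      using "1.IH"[of E''] by auto
    have "subst_comp \<sigma> \<theta> x = subst_trm (subst_comp \<sigma> \<theta>) t"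
    proof -
      have "subst_trm \<sigma> t = subst_trm Var t"
        using x unfolding subst_trm_eq_iff by (auto simp: \<sigma>_def)
      then show ?thesis by (simp) (simp add: subst_comp_def \<sigma>_def)
    qed
    then have "solves_eqs (subst_comp \<sigma> \<theta>) E"
      using \<theta>(2) by (auto simp: solves_E solves_E'')
    moreover have "\<upsilon> = subst_comp (subst_comp \<sigma> \<theta>) \<upsilon>" if "solves_eqs \<upsilon> E" for \<upsilon>
      using that \<theta>(2) by (simp add: solves_E solves_E'' absorb subst_comp_assoc)
    ultimately show ?thesis
      using substs_comp[OF \<sigma> \<theta>(1)] by blast
  qed
  have same: "\<exists>\<theta>\<in>substs F. ?mgu \<theta> E" if E: "E = (Var x, Var x) # E'" for x E'
  proof -
    have "card (vars_eqs E') \<le> card (vars_eqs E)"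
      by (intro card_mono) (auto simp: vars_eqs_def E)
    then have "(E', E) \<in> measures [\<lambda>E. card (vars_eqs E), \<lambda>E. \<Sum>(s, t)\<leftarrow>E. size s + size t]"
      by (auto simp: E)
    moreover have "solves_eqs \<upsilon> E \<longleftrightarrow> solves_eqs \<upsilon> E'" for \<upsilon>
      by (simp add: E solves_eqs_def)
    ultimately show ?thesis
      using "1.IH"[of E'] "1.prems" by (simp add: E)
  qed
  show ?case
  proof (cases E)
    case Nil
    then show ?thesis by (intro bexI[of _ Var]) (auto simp: solves_eqs_def)
  next
    case (Cons e E')
    obtain u v where e: "e = (u, v)" by fastforce
    have uv: "subst_trm \<tau> u = subst_trm \<tau> v"
      using "1.prems"(1) by (simp add: solves_eqs_def Cons e)
    consider x where "u = Var x" | x where "v = Var x"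
      | f ss g ts where "u = Fun f ss" "v = Fun g ts"
      by (metis trm.exhaust)
    then show ?thesis
    proof cases
      case u: 1
      show ?thesis
      proof (cases "x \<in> vars_trm v")
        case True
        then have "v = Var x"
          using occurs_check[of \<tau> x v] uv u by simp
        then show ?thesis
          using same[of x E'] Cons e u by simp
      next
        case False
        then show ?thesis
          using eliminate[of u v E' x v] Cons e u by simp
      qed
    next
      case v: 2
      show ?thesis
      proof (cases "x \<in> vars_trm u")
        case True
        then have "u = Var x"
          using occurs_check[of \<tau> x u] uv v by simp
        then show ?thesis
          using same[of x E'] Cons e v by simp
      next
        case False
        then show ?thesis
          using eliminate[of u v E' x u] Cons e v by simp
      qed
    next
      case 3
      have fg: "f = g" "map (subst_trm \<tau>) ss = map (subst_trm \<tau>) ts"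
        using uv 3 by auto
      then have len: "length ss = length ts"
        by (metis length_map)
      let ?E = "zip ss ts @ E'"
      have unions: "(\<Union>(s, t)\<in>set (zip ss ts). vars_trm s \<union> vars_trm t) =
          (\<Union>s\<in>set ss. vars_trm s) \<union> (\<Union>t\<in>set ts. vars_trm t)"
        using len by (induction ss ts rule: list_induct2) auto
      have "vars_eqs ?E = vars_eqs E"
        unfolding vars_eqs_def Cons e 3 using unions by auto
      \<comment> \<open>\<open>size_list\<close> adds one per entry, hence the correction by both
        lengths. The second conjunct rules out truncation in the subtraction on naturals.\<close>
      moreover have "(\<Sum>(s, t)\<leftarrow>zip ss ts. size s + size t) = size_list size ss + size_list size ts - 2 * length ss
          \<and> 2 * length ss \<le> size_list size ss + size_list size ts"
        using len by (induction ss ts rule: list_induct2) auto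
      ultimately have "(?E, E) \<in> measures [\<lambda>E. card (vars_eqs E), \<lambda>E. \<Sum>(s, t)\<leftarrow>E. size s + size t]"
        by (auto simp: Cons e 3)
      moreover have "map (subst_trm \<upsilon>) ss = map (subst_trm \<upsilon>) ts \<longleftrightarrow> solves_eqs \<upsilon> (zip ss ts)" for \<upsilon>
        using len unfolding solves_eqs_def by (induction ss ts rule: list_induct2) auto
      then have eq: "solves_eqs \<upsilon> E \<longleftrightarrow> solves_eqs \<upsilon> ?E" for \<upsilon>
        by (fastforce simp: Cons e 3 solves_eqs_def fg(1))
      moreover have "\<forall>(s, t)\<in>set ?E. s \<in> trms F \<and> t \<in> trms F"
        using "1.prems"(2) by (auto simp: Cons e 3 Fun_in_trms dest: set_zip_leftD set_zip_rightD)
      ultimately show ?thesis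
        using "1.IH"[of ?E] "1.prems"(1) by simp
    qed
  qed
qed

text \<open>Unifying two atoms means solving the equations between their arguments. By idempotence
  each unifier serves as its own factor \<open>\<delta>\<close>, so the factor lies in
  \<open>substs F\<close>.\<close>

lemma mgu_exists:
  assumes "\<tau> \<in> unifiers F [A] [B]" "A \<in> TB F Q" "B \<in> TB F Q"
  shows "\<exists>\<theta>. mgu F \<theta> [A] [B]"
proof -
  obtain p ss q ts where AB: "A = Atm p ss" "B = Atm q ts" by (meson atm.exhaust)
  have pq: "p = q" "map (subst_trm \<tau>) ss = map (subst_trm \<tau>) ts"
    using assms(1) by (auto simp: unifiers_def AB)
  then have len: "length ss = length ts"
    by (metis length_map)
  have eq: "\<upsilon> \<in> unifiers F [A] [B] \<longleftrightarrow> \<upsilon> \<in> substs F \<and> solves_eqs \<upsilon> (zip ss ts)" for \<upsilon>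
    using len unfolding solves_eqs_def unifiers_def AB pq(1)
    by (induction ss ts rule: list_induct2) auto
  have "\<forall>(s, t)\<in>set (zip ss ts). s \<in> trms F \<and> t \<in> trms F"
    using assms(2,3) by (auto simp: TB_def AB dest: set_zip_leftD set_zip_rightD)
  then show ?thesis
    using idempotent_mgu_eqs[of \<tau> "zip ss ts" F] assms(1) unfolding mgu_def Ball_def eq by blast
qed

text \<open>The inverse of the renaming is put into the factor: \<open>\<delta>\<close> becomes
  \<open>subst_comp \<rho>' \<delta>\<close>.\<close>

lemma mgu_comp_renaming:
  fixes As Bs :: "('p, 'f, 'v) atm list"
  assumes "mgu F \<theta> As Bs" "renaming \<rho>"
  shows "mgu F (subst_comp \<theta> \<rho>) As Bs"
proof -
  obtain \<rho>' where \<rho>': "renaming \<rho>'" "subst_comp \<rho> \<rho>' = Var"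
    using renaming_inverse assms(2) by blast
  have \<theta>: "\<theta> \<in> substs F" "map (subst_atm \<theta>) As = map (subst_atm \<theta>) Bs"
    using assms(1)[unfolded mgu_def, THEN conjunct1] by (simp_all add: unifiers_def)
  have "map (subst_atm (subst_comp \<theta> \<rho>)) As = map (subst_atm (subst_comp \<theta> \<rho>)) Bs"
    unfolding map_subst_atm_comp \<theta>(2) ..
  then have "subst_comp \<theta> \<rho> \<in> unifiers F As Bs"
    using substs_comp[OF \<theta>(1) renaming_in_substs[OF assms(2)]] by (simp add: unifiers_def del: map_map)
  moreover have "\<exists>\<delta>\<in>substs F. \<tau> = subst_comp (subst_comp \<theta> \<rho>) \<delta>" if \<tau>: "\<tau> \<in> unifiers F As Bs" for \<tau>
  proof -
    obtain \<delta> where \<delta>: "\<delta> \<in> substs F" "\<tau> = subst_comp \<theta> \<delta>"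
      using bspec[OF assms(1)[unfolded mgu_def, THEN conjunct2] \<tau>] by (rule bexE)
    have "subst_comp (subst_comp \<theta> \<rho>) (subst_comp \<rho>' \<delta>) = subst_comp \<theta> (subst_comp (subst_comp \<rho> \<rho>') \<delta>)"
      by (simp only: subst_comp_assoc)
    then have "\<tau> = subst_comp (subst_comp \<theta> \<rho>) (subst_comp \<rho>' \<delta>)"
      by (simp add: \<rho>'(2) \<delta>(2))
    then show ?thesis
      using substs_comp[OF renaming_in_substs[OF \<rho>'(1)] \<delta>(1)] by blast
  qed
  ultimately show ?thesis
    by (auto simp: mgu_def)
qed

section \<open>Derivations\<close>

text \<open>The set that standardization apart in \<open>sld_derivation\<close> keeps the next input
  clause away from. With the empty query it is the contribution of a segment of steps.\<close>

definition derivation_vars ::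
  "('p, 'f, 'v) query \<Rightarrow> (('p, 'f, 'v) clause \<times> ('f, 'v) subst) list \<Rightarrow> 'v set" where
  "derivation_vars Q0 ds = vars_query Q0 \<union> (\<Union>(D, \<sigma>)\<in>set ds. vars_clause D \<union> vars_subst \<sigma>)"

text \<open>Not restricted to the variables of the initial query, because continuations act on
  queries that contain variables of input clauses.\<close>

definition answer :: "(('p, 'f, 'v) clause \<times> ('f, 'v) subst) list \<Rightarrow> ('f, 'v) subst" where
  "answer ds = foldr subst_comp (map snd ds) Var"

lemma answer_Nil [simp]: "answer [] = Var"
  by (simp add: answer_def)

lemma answer_Cons [simp]: "answer (d # ds) = subst_comp (snd d) (answer ds)"
  by (simp add: answer_def)

lemma answer_append [simp]: "answer (ds @ ds') = subst_comp (answer ds) (answer ds')"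
  by (induction ds) (auto simp: subst_comp_assoc)

lemma answer_in_substs: "(\<And>d. d \<in> set ds \<Longrightarrow> snd d \<in> substs F) \<Longrightarrow> answer ds \<in> substs F"
  by (induction ds) (auto intro: substs_comp)

lemma vars_answer:
  "vars_trm (answer ds x) \<subseteq> insert x (\<Union>(D, \<sigma>)\<in>set ds. vars_clause D \<union> vars_subst \<sigma>)"
proof (induction ds arbitrary: x)
  case (Cons d ds)
  show ?case
    using Cons.IH vars_trm_subst_app[of "snd d" x]
    by (cases d) (fastforce simp: subst_comp_def vars_subst_trm)
qed simp

lemma derivation_vars_append:
  "derivation_vars Q0 (ds @ ds') = derivation_vars Q0 ds \<union> derivation_vars [] ds'"
  by (auto simp: derivation_vars_def vars_query_def)

lemma vars_answer_derivation_vars: "vars_trm (answer ds x) \<subseteq> insert x (derivation_vars [] ds)"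
  using vars_answer[of ds x] by (simp add: derivation_vars_def vars_query_def)

lemma vars_query_simps [simp]:
  "vars_query [] = {}" "vars_query (A # As) = vars_atm A \<union> vars_query As"
  "vars_query (As @ Bs) = vars_query As \<union> vars_query Bs"
  by (auto simp: vars_query_def)

lemma vars_query_subst: "vars_query (map (subst_atm \<sigma>) As) \<subseteq> vars_query As \<union> vars_subst \<sigma>"
  using vars_trm_subst_app[of \<sigma>] by (fastforce simp: vars_query_def vars_subst_atm)

lemma mgu_in_substs: "mgu F \<theta> As Bs \<Longrightarrow> \<theta> \<in> substs F"
  by (simp add: mgu_def unifiers_def)

lemma sld_mgus_in_substs:
  "sld_derivation F P Q0 ds G \<Longrightarrow> d \<in> set ds \<Longrightarrow> snd d \<in> substs F"
  by (induction rule: sld_derivation.induct) (auto dest: mgu_in_substs)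

lemma finite_derivation_vars:
  "sld_derivation F P Q0 ds G \<Longrightarrow> finite (derivation_vars Q0 ds)"
  using sld_mgus_in_substs[of F P Q0 ds G]
  by (auto simp: derivation_vars_def intro!: finite_vars_subst[of _ F])

text \<open>Makes a clause that avoids the history also avoid the current query.\<close>

lemma sld_query_vars:
  "sld_derivation F P Q0 ds G \<Longrightarrow> vars_query G \<subseteq> derivation_vars Q0 ds"
proof (induction rule: sld_derivation.induct)
  case (step ds As A As' C C' \<theta>)
  then show ?case
    using vars_query_subst[of \<theta> "As @ body C' @ As'"]
    by (fastforce simp: derivation_vars_def vars_clause_conv)
qed (simp add: derivation_vars_def)

lemma variant_clause_TB:
  assumes "variant_clause C C'" "C \<in> clauses F Q"
  shows "C' \<in> clauses F Q"
  using assms by (fastforce simp: variant_clause_def clauses_def dest: renaming_in_substs intro: TB_subst)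

text \<open>Provides the condition under which \<open>mgu_exists\<close> applies to a selected
  atom.\<close>

lemma sld_query_TB:
  "sld_derivation F P Q0 ds G \<Longrightarrow> P \<subseteq> clauses F Q \<Longrightarrow> set Q0 \<subseteq> TB F Q \<Longrightarrow> set G \<subseteq> TB F Q"
proof (induction rule: sld_derivation.induct)
  case (step ds As A As' C C' \<theta>)
  have "C' \<in> clauses F Q"
    by (rule variant_clause_TB[OF step.hyps(3)]) (use step.prems(1) step.hyps(2) in blast)
  then show ?case
    using step mgu_in_substs[OF step.hyps(5)] by (auto simp: clauses_def intro!: TB_subst)
qed

section \<open>Lifting\<close>

definition instance_of ::
  "('f \<times> nat) set \<Rightarrow> ('p, 'f, 'v) atm \<Rightarrow> ('p, 'f, 'v) atm \<Rightarrow> bool" where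
  "instance_of F A B \<longleftrightarrow> (\<exists>\<gamma>\<in>substs F. B = subst_atm \<gamma> A)"

lemma instance_of_subst: "instance_of F A B \<Longrightarrow> \<sigma> \<in> substs F \<Longrightarrow> instance_of F A (subst_atm \<sigma> B)"
  by (metis instance_of_def subst_atm_comp substs_comp)

text \<open>On the variables \<open>W\<close>, \<open>\<sigma>\<close> is a most general substitution making each \<open>Bs ! i\<close> an instance
  of \<open>As ! i\<close>. Speaking of instances avoids renaming \<open>As\<close> apart from the derivation.\<close>

definition most_general_on ::
  "('f \<times> nat) set \<Rightarrow> 'v set \<Rightarrow> ('p, 'f, 'v) atm list \<Rightarrow> ('p, 'f, 'v) atm list \<Rightarrow> ('f, 'v) subst \<Rightarrow> bool"
  where "most_general_on F W As Bs \<sigma> \<longleftrightarrow>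
    list_all2 (instance_of F) As (map (subst_atm \<sigma>) Bs) \<and>
    (\<forall>\<tau>\<in>substs F. list_all2 (instance_of F) As (map (subst_atm \<tau>) Bs) \<longrightarrow>
      (\<exists>\<delta>\<in>substs F. \<forall>x\<in>W. \<tau> x = subst_trm \<delta> (\<sigma> x)))"

text \<open>Ranging over every history \<open>ds\<close> and every remainder \<open>G\<close> lets
  continuations be chained: resolving one atom leaves a situation of the same kind.
  \<open>\<tau>\<close> only witnesses that \<open>Bs\<close> can be matched; the comparison with
  all competitors is made by \<open>most_general_on\<close>.\<close>

definition resolvable ::
  "('f \<times> nat) set \<Rightarrow> ('p \<times> nat) set \<Rightarrow> ('p, 'f, 'v) clause set \<Rightarrow> ('p, 'f, 'v) atm list \<Rightarrow> bool" where
  "resolvable F Q P As \<longleftrightarrow> (\<forall>Q0 ds Bs G \<tau>.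
     set Q0 \<subseteq> TB F Q \<longrightarrow> sld_derivation F P Q0 ds (Bs @ G) \<longrightarrow> \<tau> \<in> substs F \<longrightarrow>
     list_all2 (instance_of F) As (map (subst_atm \<tau>) Bs) \<longrightarrow>
     (\<exists>ds'. sld_derivation F P Q0 (ds @ ds') (map (subst_atm (answer ds')) G) \<and>
       most_general_on F (derivation_vars Q0 ds) As Bs (answer ds')))"

lemma resolvableE:
  assumes "resolvable F Q P As" "set Q0 \<subseteq> TB F Q" "sld_derivation F P Q0 ds (Bs @ G)"
    "\<tau> \<in> substs F" "list_all2 (instance_of F) As (map (subst_atm \<tau>) Bs)"
  obtains ds' where "sld_derivation F P Q0 (ds @ ds') (map (subst_atm (answer ds')) G)"
    "most_general_on F (derivation_vars Q0 ds) As Bs (answer ds')" "answer ds' \<in> substs F"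
proof -
  obtain ds' where ds': "sld_derivation F P Q0 (ds @ ds') (map (subst_atm (answer ds')) G)"
    "most_general_on F (derivation_vars Q0 ds) As Bs (answer ds')"
    using assms unfolding resolvable_def by blast
  have "answer ds' \<in> substs F"
    using sld_mgus_in_substs[OF ds'(1)] by (intro answer_in_substs) auto
  then show thesis
    using that ds' by blast
qed

lemma resolvable_Nil: "resolvable F Q P []"
  unfolding resolvable_def most_general_on_def by (auto intro!: exI[of _ "[]"] simp: map_idI)

lemma subst_atm_eq_on:
  "(\<And>x. x \<in> W \<Longrightarrow> \<sigma> x = \<tau> x) \<Longrightarrow> vars_atm A \<subseteq> W \<Longrightarrow> subst_atm \<sigma> A = subst_atm \<tau> A"
  by (auto simp: subst_atm_eq_iff)

text \<open>The first atom is refuted, and any competitor factors through its answer. The factor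
  still turns the instantiated rest into instances of \<open>As\<close>, so it is a competitor for
  the second continuation, and the two factorizations combine.\<close>

lemma resolvable_Cons:
  assumes "resolvable F Q P [A]" "resolvable F Q P As"
  shows "resolvable F Q P (A # As)"
  unfolding resolvable_def
proof (intro allI impI)
  fix Q0 ds Bs' G \<tau>
  assume Q0: "set Q0 \<subseteq> TB F Q" and ds: "sld_derivation F P Q0 ds (Bs' @ G)"
    and \<tau>: "\<tau> \<in> substs F" "list_all2 (instance_of F) (A # As) (map (subst_atm \<tau>) Bs')"
  obtain B Bs where Bs': "Bs' = B # Bs"
    using \<tau>(2) by (cases Bs') auto
  let ?W = "derivation_vars Q0 ds"
  have vars: "vars_atm B \<subseteq> ?W" "vars_query Bs \<subseteq> ?W"
    using sld_query_vars[OF ds] by (auto simp: Bs')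
  obtain ds1 where ds1: "sld_derivation F P Q0 (ds @ ds1) (map (subst_atm (answer ds1)) (Bs @ G))"
      "most_general_on F ?W [A] [B] (answer ds1)" "answer ds1 \<in> substs F"
    using resolvableE[OF assms(1) Q0, of ds "[B]" "Bs @ G" \<tau>] ds \<tau> by (auto simp: Bs')
  let ?W1 = "derivation_vars Q0 (ds @ ds1)" and ?\<sigma>1 = "answer ds1"
  \<comment> \<open>\<open>answer ds2\<close> will be most general on \<open>?W1\<close> only, so
    \<open>?\<sigma>1\<close> must not lead out of it.\<close>
  have W1: "vars_trm (?\<sigma>1 x) \<subseteq> ?W1" if "x \<in> ?W" for x
    using vars_answer_derivation_vars[of ds1 x] that by (auto simp: derivation_vars_append)
  \<comment> \<open>Used twice: with \<open>\<tau>\<close> to start the second continuation, and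
    with an arbitrary competitor to prove generality.\<close>
  have factor: "\<exists>\<delta>\<in>substs F. (\<forall>x\<in>?W. \<upsilon> x = subst_trm \<delta> (?\<sigma>1 x)) \<and>
      list_all2 (instance_of F) As (map (subst_atm \<delta>) (map (subst_atm ?\<sigma>1) Bs))"
    if \<upsilon>: "\<upsilon> \<in> substs F" "list_all2 (instance_of F) (A # As) (map (subst_atm \<upsilon>) Bs')" for \<upsilon>
  proof -
    obtain \<delta> where \<delta>: "\<delta> \<in> substs F" "\<forall>x\<in>?W. \<upsilon> x = subst_trm \<delta> (?\<sigma>1 x)"
      using ds1(2) \<upsilon> by (auto simp: most_general_on_def Bs')
    have "map (subst_atm \<delta>) (map (subst_atm ?\<sigma>1) Bs) = map (subst_atm \<upsilon>) Bs"
      using vars(2) \<delta>(2)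
      by (auto simp: vars_query_def subst_comp_def subst_atm_eq_iff simp flip: subst_atm_comp)
    then show ?thesis
      using \<delta> \<upsilon>(2) by (intro bexI[of _ \<delta>]) (simp_all only: Bs' list.map list_all2_Cons simp_thms)
  qed
  obtain \<delta> where \<delta>: "\<delta> \<in> substs F"
      "list_all2 (instance_of F) As (map (subst_atm \<delta>) (map (subst_atm ?\<sigma>1) Bs))"
    using factor \<tau> by blast
  obtain ds2 where ds2: "sld_derivation F P Q0 ((ds @ ds1) @ ds2)
        (map (subst_atm (answer ds2)) (map (subst_atm ?\<sigma>1) G))"
      "most_general_on F ?W1 As (map (subst_atm ?\<sigma>1) Bs) (answer ds2)" "answer ds2 \<in> substs F"
    using resolvableE[OF assms(2) Q0 _ \<delta>, of "ds @ ds1" "map (subst_atm ?\<sigma>1) G"] ds1(1) by auto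
  let ?\<sigma>2 = "answer ds2"
  have "most_general_on F ?W (A # As) Bs' (answer (ds1 @ ds2))"
    unfolding most_general_on_def
  proof (intro conjI ballI impI)
    show "list_all2 (instance_of F) (A # As) (map (subst_atm (answer (ds1 @ ds2))) Bs')"
      using ds1(2) ds2(2,3) by (auto simp: most_general_on_def Bs' intro: instance_of_subst)
  next
    fix \<upsilon> assume \<upsilon>: "\<upsilon> \<in> substs F" "list_all2 (instance_of F) (A # As) (map (subst_atm \<upsilon>) Bs')"
    obtain \<delta>1 where \<delta>1: "\<delta>1 \<in> substs F" "\<forall>x\<in>?W. \<upsilon> x = subst_trm \<delta>1 (?\<sigma>1 x)"
        "list_all2 (instance_of F) As (map (subst_atm \<delta>1) (map (subst_atm ?\<sigma>1) Bs))"
      using factor[OF \<upsilon>] by blast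
    obtain \<delta>2 where \<delta>2: "\<delta>2 \<in> substs F" "\<forall>x\<in>?W1. \<delta>1 x = subst_trm \<delta>2 (?\<sigma>2 x)"
      using ds2(2) \<delta>1(1,3) unfolding most_general_on_def by blast
    have "\<upsilon> x = subst_trm \<delta>2 (answer (ds1 @ ds2) x)" if "x \<in> ?W" for x
    proof -
      have "subst_trm \<delta>1 (?\<sigma>1 x) = subst_trm (subst_comp ?\<sigma>2 \<delta>2) (?\<sigma>1 x)"
        unfolding subst_trm_eq_iff using W1[OF that] \<delta>2(2) by (auto simp: subst_comp_def)
      then show ?thesis
        using \<delta>1(2) that by (simp add: subst_comp_def[of ?\<sigma>1])
    qed
    then show "\<exists>\<delta>\<in>substs F. \<forall>x\<in>?W. \<upsilon> x = subst_trm \<delta> (answer (ds1 @ ds2) x)"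
      using \<delta>2(1) by blast
  qed
  then show "\<exists>ds'. sld_derivation F P Q0 (ds @ ds') (map (subst_atm (answer ds')) G) \<and>
       most_general_on F ?W (A # As) Bs' (answer ds')"
    using ds2(1) by (intro exI[of _ "ds1 @ ds2"]) simp
qed

lemma resolvable_list: "(\<And>A. A \<in> set As \<Longrightarrow> resolvable F Q P [A]) \<Longrightarrow> resolvable F Q P As"
  by (induction As) (auto intro: resolvable_Nil resolvable_Cons)

text \<open>Variable disjointness glues the matchers of the single \<open>As ! i\<close> and \<open>\<sigma>\<close> to a unifier.\<close>

lemma glue_unifier:
  assumes C: "C \<in> clauses F Q" and As: "length As = length (body C)"
    and disjC: "\<forall>i < length As. vars_atm (As ! i) \<inter> vars_clause C = {}"
    and disj: "\<forall>i < length As. \<forall>j < length As. i \<noteq> j \<longrightarrow> vars_atm (As ! i) \<inter> vars_atm (As ! j) = {}"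
    and \<sigma>: "\<sigma> \<in> substs F"
    and inst: "list_all2 (instance_of F) As (map (subst_atm \<sigma>) (body C))"
  obtains \<eta> where "\<eta> \<in> unifiers F (body C) As" "\<And>x. x \<in> vars_clause C \<Longrightarrow> \<eta> x = \<sigma> x"
proof -
  have "\<forall>i<length As. \<exists>\<gamma>\<in>substs F. subst_atm \<sigma> (body C ! i) = subst_atm \<gamma> (As ! i)"
    using inst As by (auto simp: list_all2_conv_all_nth instance_of_def)
  then obtain \<gamma> where \<gamma>: "\<And>i. i < length As \<Longrightarrow> \<gamma> i \<in> substs F"
      "\<And>i. i < length As \<Longrightarrow> subst_atm \<sigma> (body C ! i) = subst_atm (\<gamma> i) (As ! i)"
    by metis
  \<comment> \<open>A variable lies in at most one \<open>As ! i\<close>, so \<open>THE\<close>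
    picks that index. All other variables, in particular those of \<open>C\<close>, keep their value
    under \<open>\<sigma>\<close>; ground atoms cause no conflict even when repeated.\<close>
  define \<eta> where "\<eta> x = (if \<exists>i<length As. x \<in> vars_atm (As ! i)
      then \<gamma> (THE i. i < length As \<and> x \<in> vars_atm (As ! i)) x else \<sigma> x)" for x
  have \<eta>_As: "\<eta> x = \<gamma> i x" if "i < length As" "x \<in> vars_atm (As ! i)" for x i
  proof -
    have "(THE i. i < length As \<and> x \<in> vars_atm (As ! i)) = i"
      using that disj by (intro the_equality) auto
    then show ?thesis using that by (auto simp: \<eta>_def)
  qed
  have \<eta>_C: "\<eta> x = \<sigma> x" if "x \<in> vars_clause C" for x
    using that disjC by (auto simp: \<eta>_def)
  have "\<eta> \<in> substs F"
  proof (rule substs_finite_supportI)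
    show "finite (subst_dom \<sigma> \<union> vars_query As)"
      using \<sigma> by (simp add: substs_def)
    show "\<eta> x \<in> trms F" for x
    proof (cases "\<exists>i<length As. x \<in> vars_atm (As ! i)")
      case True
      then show ?thesis using \<eta>_As \<gamma>(1) substsD by metis
    next
      case False
      then show ?thesis using \<sigma> substsD by (auto simp: \<eta>_def)
    qed
    show "\<eta> x = Var x" if "x \<notin> subst_dom \<sigma> \<union> vars_query As" for x
      using that nth_mem[of _ As] by (auto simp: \<eta>_def subst_dom_def vars_query_def)
  qed
  moreover have "subst_atm \<eta> (body C ! i) = subst_atm \<eta> (As ! i)" if i: "i < length As" for i
  proof -
    have "vars_atm (body C ! i) \<subseteq> vars_clause C"
      using i As by (auto simp: vars_clause_conv vars_query_def)
    then have "subst_atm \<eta> (body C ! i) = subst_atm \<sigma> (body C ! i)"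
      using \<eta>_C by (auto simp: subst_atm_eq_iff)
    also have "\<dots> = subst_atm (\<gamma> i) (As ! i)"
      using \<gamma>(2) i by blast
    also have "\<dots> = subst_atm \<eta> (As ! i)"
      using \<eta>_As i by (auto simp: subst_atm_eq_iff)
    finally show ?thesis .
  qed
  ultimately have "\<eta> \<in> unifiers F (body C) As"
    using As by (auto simp: unifiers_def intro: nth_equalityI)
  then show thesis
    using that \<eta>_C by blast
qed

text \<open>\<open>B\<close> is resolved with a fresh variant of \<open>C\<close>, and the new body
  is refuted by means of \<open>As\<close>. The answer is correct because it turns the body into
  instances of \<open>As\<close>; glued to a unifier it factors through \<open>\<theta>\<close>, so
  the head becomes an instance of \<open>A\<close>. It is most general because matching
  \<open>B\<close> against \<open>A\<close> yields a unifier of \<open>B\<close> and the fresh head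
  whose body consists of instances of \<open>As\<close>.\<close>

lemma resolvable_T_pi:
  fixes P :: "('p, 'f, 'v::infinite) clause set"
  assumes P: "P \<subseteq> clauses F Q" "C \<in> P" and A: "A \<in> T_pi F {C} I"
    and I: "\<And>A'. A' \<in> I \<Longrightarrow> resolvable F Q P [A']"
  shows "resolvable F Q P [A]"
  unfolding resolvable_def
proof (intro allI impI)
  fix Q0 ds Bs' G \<tau>0
  assume Q0: "set Q0 \<subseteq> TB F Q" and ds: "sld_derivation F P Q0 ds (Bs' @ G)"
    and \<tau>0: "\<tau>0 \<in> substs F" "list_all2 (instance_of F) [A] (map (subst_atm \<tau>0) Bs')"
  obtain As \<theta> where As: "set As \<subseteq> I" "length As = length (body C)"
      "\<forall>i < length As. vars_atm (As ! i) \<inter> vars_clause C = {}"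
      "\<forall>i < length As. \<forall>j < length As. i \<noteq> j \<longrightarrow> vars_atm (As ! i) \<inter> vars_atm (As ! j) = {}"
    and \<theta>: "mgu F \<theta> (body C) As" and A_def: "A = subst_atm \<theta> (head C)"
    using A by (auto simp: T_pi_def)
  have C: "C \<in> clauses F Q" using P by blast
  have \<theta>s: "\<theta> \<in> substs F" using mgu_in_substs[OF \<theta>] .
  have \<theta>_As: "map (subst_atm \<theta>) (body C) = map (subst_atm \<theta>) As"
    using \<theta> by (simp add: mgu_def unifiers_def)
  have resAs: "resolvable F Q P As"
    using As(1) I by (blast intro: resolvable_list)
  obtain B where Bs': "Bs' = [B]"
    using \<tau>0(2) by (cases Bs') auto
  let ?W = "derivation_vars Q0 ds"
  have B: "vars_atm B \<subseteq> ?W" "B \<in> TB F Q"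
    using sld_query_vars[OF ds] sld_query_TB[OF ds P(1) Q0] by (auto simp: Bs')
  obtain \<pi> where \<pi>: "bij \<pi>" "finite {x. \<pi> x \<noteq> x}" "\<pi> ` vars_clause C \<inter> ?W = {}"
    by (rule fresh_renaming[OF finite_vars_clause finite_derivation_vars[OF ds]])
  define \<rho> where "\<rho> = (\<lambda>x. Var (\<pi> x) :: ('f, 'v) trm)"
  define C' where "C' = subst_clause \<rho> C"
  have \<rho>: "renaming \<rho>" "\<rho> \<in> substs F"
    using \<pi>(1,2) renaming_in_substs by (auto simp: renaming_def \<rho>_def)
  have variant: "variant_clause C C'"
    using \<rho>(1) by (auto simp: variant_clause_def C'_def)
  have vars_C': "vars_clause C' = \<pi> ` vars_clause C"
    by (auto simp: vars_clause_conv C'_def vars_subst_atm \<rho>_def vars_query_def)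
  have C'TB: "C' \<in> clauses F Q"
    using variant_clause_TB[OF variant C] .
  have unify: "\<exists>\<tau>'. \<tau>' \<in> unifiers F [B] [head C'] \<and> (\<forall>x\<in>?W. \<tau>' x = \<tau> x) \<and>
      map (subst_atm \<tau>') (body C') = map (subst_atm \<gamma>) (map (subst_atm \<theta>) (body C))"
    if \<tau>: "\<tau> \<in> substs F" "\<gamma> \<in> substs F" "subst_atm \<tau> B = subst_atm \<gamma> A" for \<tau> \<gamma>
  proof -
    \<comment> \<open>The given \<open>\<tau>\<close> on the history, and \<open>\<theta>\<close>
      followed by \<open>\<gamma>\<close>, carried along \<open>\<pi>\<close>, on the fresh clause.
      Freshness keeps the first two cases from overlapping.\<close>
    define \<tau>' where "\<tau>' x = (if x \<in> ?W then \<tau> x else if x \<in> vars_clause C'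
      then subst_trm \<gamma> (\<theta> (inv \<pi> x)) else Var x)" for x
    have "\<tau>' \<in> substs F"
      using \<tau>(1,2) \<theta>s
      by (intro substs_finite_supportI[of "?W \<union> vars_clause C'"])
        (auto simp: \<tau>'_def finite_derivation_vars[OF ds] substs_def intro!: trms_subst)
    moreover have W: "\<forall>x\<in>?W. \<tau>' x = \<tau> x"
      by (simp add: \<tau>'_def)
    moreover have "subst_comp \<rho> \<tau>' x = subst_comp \<theta> \<gamma> x" if "x \<in> vars_clause C" for x
      using that \<pi>(1,3) bij_is_inj[OF \<pi>(1)] by (auto simp: \<tau>'_def subst_comp_def \<rho>_def vars_C')
    then have inst: "subst_atm (subst_comp \<rho> \<tau>') D = subst_atm (subst_comp \<theta> \<gamma>) D"
      if "vars_atm D \<subseteq> vars_clause C" for D :: "('p, 'f, 'v) atm"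
      using that by (intro subst_atm_eq_on[of "vars_clause C"])
    have body: "map (subst_atm \<tau>') (body C') = map (subst_atm \<gamma>) (map (subst_atm \<theta>) (body C))"
      using inst by (auto simp: C'_def vars_clause_conv vars_query_def)
    have "subst_atm \<tau>' B = subst_atm \<tau> B"
      using W B(1) subst_atm_eq_on by metis
    moreover have "subst_atm \<tau> B = subst_atm \<tau>' (head C')"
      using inst[of "head C"] \<tau>(3) by (simp add: C'_def A_def vars_clause_conv)
    ultimately have "\<tau>' \<in> unifiers F [B] [head C']"
      by (simp add: unifiers_def)
    then show ?thesis
      using W body by blast
  qed
  \<comment> \<open>\<open>\<theta>\<close> makes the body equal to \<open>As\<close>, so instances
    of the body under \<open>\<theta>\<close> are instances of \<open>As\<close>.\<close>
  have inst_body: "list_all2 (instance_of F) As (map (subst_atm \<gamma>) (map (subst_atm \<theta>) (body C)))"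
    if "\<gamma> \<in> substs F" for \<gamma>
    unfolding \<theta>_As using that \<theta>s
    by (auto simp: list_all2_conv_all_nth instance_of_def intro!: bexI[of _ "subst_comp \<theta> \<gamma>"] substs_comp)
  obtain \<gamma>0 where \<gamma>0: "\<gamma>0 \<in> substs F" "subst_atm \<tau>0 B = subst_atm \<gamma>0 A"
    using \<tau>0(2) by (auto simp: Bs' instance_of_def)
  obtain \<sigma>1 where \<sigma>1: "mgu F \<sigma>1 [B] [head C']"
    using unify[OF \<tau>0(1) \<gamma>0] mgu_exists B(2) C'TB by (fastforce simp: clauses_def)
  have \<sigma>1s: "\<sigma>1 \<in> substs F" using mgu_in_substs[OF \<sigma>1] .
  \<comment> \<open>Serves \<open>\<tau>0\<close>, to start the refutation of the body, and every
    competitor, to prove generality.\<close>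
  have factor: "\<exists>\<delta>\<in>substs F. (\<forall>x\<in>?W. \<tau> x = subst_trm \<delta> (\<sigma>1 x)) \<and>
      list_all2 (instance_of F) As (map (subst_atm \<delta>) (map (subst_atm \<sigma>1) (body C')))"
    if \<tau>: "\<tau> \<in> substs F" "\<gamma> \<in> substs F" "subst_atm \<tau> B = subst_atm \<gamma> A" for \<tau> \<gamma>
  proof -
    obtain \<tau>' where \<tau>': "\<tau>' \<in> unifiers F [B] [head C']" "\<forall>x\<in>?W. \<tau>' x = \<tau> x"
      "map (subst_atm \<tau>') (body C') = map (subst_atm \<gamma>) (map (subst_atm \<theta>) (body C))"
      using unify[OF \<tau>] by blast
    then obtain \<delta> where \<delta>: "\<delta> \<in> substs F" "\<tau>' = subst_comp \<sigma>1 \<delta>"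
      using \<sigma>1 unfolding mgu_def by blast
    have "map (subst_atm \<delta>) (map (subst_atm \<sigma>1) (body C')) = map (subst_atm \<tau>') (body C')"
      by (simp add: \<delta>(2))
    then show ?thesis
      using \<delta> \<tau>'(2) inst_body[OF \<tau>(2)] unfolding \<tau>'(3) by (metis subst_comp_def)
  qed
  let ?ds1 = "ds @ [(C', \<sigma>1)]"
  let ?W1 = "derivation_vars Q0 ?ds1"
  have ds1: "sld_derivation F P Q0 ?ds1 (map (subst_atm \<sigma>1) (body C') @ map (subst_atm \<sigma>1) G)"
    using sld_derivation.step[of F P Q0 ds "[]" B G C C' \<sigma>1] ds P(2) variant \<sigma>1 \<pi>(3)
    by (simp add: Bs' vars_C' derivation_vars_def)
  obtain \<delta>0 where \<delta>0: "\<delta>0 \<in> substs F"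
      "list_all2 (instance_of F) As (map (subst_atm \<delta>0) (map (subst_atm \<sigma>1) (body C')))"
    using factor[OF \<tau>0(1) \<gamma>0] by blast
  obtain ds2 where ds2: "sld_derivation F P Q0 (?ds1 @ ds2)
        (map (subst_atm (answer ds2)) (map (subst_atm \<sigma>1) G))"
      "most_general_on F ?W1 As (map (subst_atm \<sigma>1) (body C')) (answer ds2)" "answer ds2 \<in> substs F"
    using resolvableE[OF resAs Q0 ds1 \<delta>0] by blast
  let ?\<sigma>2 = "answer ds2" and ?ds' = "(C', \<sigma>1) # ds2"
  have "instance_of F A (subst_atm (answer ?ds') B)"
  proof -
    \<comment> \<open>Including \<open>\<rho>\<close> moves the argument back from \<open>C'\<close>
      to \<open>C\<close> itself, the clause for which disjointness from \<open>As\<close> is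
      known.\<close>
    let ?\<sigma> = "subst_comp \<rho> (subst_comp \<sigma>1 ?\<sigma>2)"
    have "?\<sigma> \<in> substs F"
      using \<rho>(2) \<sigma>1s ds2(3) by (intro substs_comp)
    moreover have "map (subst_atm ?\<sigma>) (body C) = map (subst_atm ?\<sigma>2) (map (subst_atm \<sigma>1) (body C'))"
      by (simp add: C'_def del: map_subst_atm_comp)
    then have "list_all2 (instance_of F) As (map (subst_atm ?\<sigma>) (body C))"
      using ds2(2) unfolding most_general_on_def by argo
    ultimately obtain \<eta> where \<eta>: "\<eta> \<in> unifiers F (body C) As" "\<And>x. x \<in> vars_clause C \<Longrightarrow> \<eta> x = ?\<sigma> x"
      using glue_unifier[OF C As(2-4)] by metis
    obtain \<delta> where \<delta>: "\<delta> \<in> substs F" "\<eta> = subst_comp \<theta> \<delta>"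
      using \<theta> \<eta>(1) unfolding mgu_def by blast
    have "subst_atm \<sigma>1 B = subst_atm \<sigma>1 (head C')"
      using \<sigma>1 by (simp add: mgu_def unifiers_def)
    then have "subst_atm (answer ?ds') B = subst_atm ?\<sigma> (head C)"
      by (simp add: C'_def)
    also have "\<dots> = subst_atm \<eta> (head C)"
      using \<eta>(2) by (intro subst_atm_eq_on[of "vars_clause C"]) (auto simp: vars_clause_conv)
    finally show ?thesis
      using \<delta> by (auto simp: instance_of_def A_def)
  qed
  moreover have "\<exists>\<delta>\<in>substs F. \<forall>x\<in>?W. \<tau> x = subst_trm \<delta> (answer ?ds' x)"
    if \<tau>: "\<tau> \<in> substs F" "instance_of F A (subst_atm \<tau> B)" for \<tau>
  proof -
    obtain \<delta>1 where \<delta>1: "\<delta>1 \<in> substs F" "\<forall>x\<in>?W. \<tau> x = subst_trm \<delta>1 (\<sigma>1 x)"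
        "list_all2 (instance_of F) As (map (subst_atm \<delta>1) (map (subst_atm \<sigma>1) (body C')))"
      using factor[OF \<tau>(1)] \<tau>(2) unfolding instance_of_def by blast
    obtain \<delta>2 where \<delta>2: "\<delta>2 \<in> substs F" "\<forall>x\<in>?W1. \<delta>1 x = subst_trm \<delta>2 (?\<sigma>2 x)"
      using ds2(2) \<delta>1(1,3) unfolding most_general_on_def by blast
    have "\<tau> x = subst_trm \<delta>2 (answer ?ds' x)" if "x \<in> ?W" for x
    proof -
      \<comment> \<open>This holds for a non-relevant mgu as well, since \<open>?W1\<close> records
        all variables of \<open>\<sigma>1\<close>.\<close>
      have "vars_trm (\<sigma>1 x) \<subseteq> ?W1"
        using vars_trm_subst_app[of \<sigma>1 x] that by (auto simp: derivation_vars_def)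
      then have "subst_trm \<delta>1 (\<sigma>1 x) = subst_trm (subst_comp ?\<sigma>2 \<delta>2) (\<sigma>1 x)"
        unfolding subst_trm_eq_iff using \<delta>2(2) by (auto simp: subst_comp_def)
      then show ?thesis
        using \<delta>1(2) that by (simp add: subst_comp_def[of \<sigma>1])
    qed
    then show ?thesis
      using \<delta>2(1) by blast
  qed
  ultimately have "most_general_on F ?W [A] Bs' (answer ?ds')"
    by (simp add: most_general_on_def Bs')
  moreover have "sld_derivation F P Q0 (ds @ ?ds') (map (subst_atm (answer ?ds')) G)"
    using ds2(1) by simp
  ultimately show "\<exists>ds'. sld_derivation F P Q0 (ds @ ds') (map (subst_atm (answer ds')) G) \<and>
       most_general_on F ?W [A] Bs' (answer ds')"
    by blast
qed

section \<open>Completeness\<close>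

text \<open>Mgus need not be idempotent, so the renaming can be absorbed into the last one.\<close>

lemma refutation_rename_answer:
  assumes "sld_derivation F P Q0 ds []" "Q0 \<noteq> []" "renaming \<rho>"
  obtains ds' where "sld_derivation F P Q0 ds' []" "answer ds' = subst_comp (answer ds) \<rho>"
  using assms(1)
proof (cases rule: sld_derivation.cases)
  case start
  then show thesis using assms(2) by simp
next
  case (step ds1 As A As' C C' \<theta>)
  then have "sld_derivation F P Q0 (ds1 @ [(C', subst_comp \<theta> \<rho>)])
      (map (subst_atm (subst_comp \<theta> \<rho>)) (As @ body C' @ As'))"
    using mgu_comp_renaming[OF step(7) assms(3)] by (intro sld_derivation.step) auto
  \<comment> \<open>The last resolvent is empty, so changing the last mgu leaves the final query
    unchanged.\<close>
  moreover have "As @ body C' @ As' = []"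
    using step(2) by auto
  moreover have "answer (ds1 @ [(C', subst_comp \<theta> \<rho>)]) = subst_comp (answer ds) \<rho>"
    by (simp add: step(1) subst_comp_assoc)
  ultimately show thesis
    using that by auto
qed

text \<open>The two halves of \<open>most_general_on\<close> give the two directions: matching makes
  the answer instance an instance of \<open>A\<close>, and generality against the substitution of
  \<open>ts\<close> for \<open>Vs\<close> makes \<open>A\<close> an instance of it.\<close>

lemma resolvable_in_s_semantics:
  fixes P :: "('p, 'f, 'v::infinite) clause set"
  assumes "resolvable F Q P [A]" "A \<in> TB F Q"
  shows "A \<in> s_semantics F Q P"
proof -
  obtain p ts where A: "A = Atm p ts" "(p, length ts) \<in> Q" "set ts \<subseteq> trms F"
    using assms(2) by (auto simp: TB_def)
  obtain X :: "'v set" where "finite X" "card X = length ts"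
    using infinite_arbitrarily_large[OF infinite_UNIV] by metis
  \<comment> \<open>\<open>Vs\<close> may overlap the variables of \<open>A\<close>: the
    substitution \<open>\<tau>\<close> below is simultaneous, so it still maps \<open>?B\<close> to
    \<open>A\<close>.\<close>
  then obtain Vs :: "'v list" where Vs: "distinct Vs" "length Vs = length ts"
    by (metis distinct_card finite_distinct_list)
  let ?B = "Atm p (map Var Vs) :: ('p, 'f, 'v) atm"
  define \<tau> where "\<tau> x = (case map_of (zip Vs ts) x of Some t \<Rightarrow> t | None \<Rightarrow> Var x)" for x
  have "map \<tau> Vs = ts"
    using Vs by (intro nth_equalityI) (auto simp: \<tau>_def map_of_zip_nth)
  then have \<tau>B: "subst_atm \<tau> ?B = A"
    by (simp add: A(1) comp_def)
  have "\<tau> \<in> substs F"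
    using A(3) Vs by (intro substs_finite_supportI[of "set Vs"])
      (auto simp: \<tau>_def trms.intros split: option.splits dest!: map_of_SomeD dest: set_zip_leftD set_zip_rightD)
  moreover have "set [?B] \<subseteq> TB F Q"
    using A(2) Vs by (auto simp: TB_def intro: trms.intros)
  moreover have "instance_of F A A"
    by (auto simp: instance_of_def intro!: bexI[of _ Var])
  ultimately obtain ds where ds: "sld_derivation F P [?B] ds []"
      "most_general_on F (derivation_vars [?B] []) [A] [?B] (answer ds)"
    using resolvableE[OF assms(1), of "[?B]" "[]" "[?B]" "[]" \<tau>] \<tau>B by (auto simp: sld_derivation.start)
  let ?A0 = "subst_atm (answer ds) ?B"
  obtain \<gamma> where \<gamma>: "subst_atm \<gamma> A = ?A0"
    using ds(2) by (auto simp: most_general_on_def instance_of_def)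
  obtain \<delta> where \<delta>: "\<forall>x\<in>vars_atm ?B. \<tau> x = subst_trm \<delta> (answer ds x)"
    using ds(2) \<open>\<tau> \<in> substs F\<close> \<open>instance_of F A A\<close> \<tau>B
    by (auto simp: most_general_on_def derivation_vars_def)
  have "subst_atm \<delta> ?A0 = A"
    unfolding \<tau>B[symmetric] subst_atm_comp[symmetric] subst_atm_eq_iff
    using \<delta> by (auto simp: subst_comp_def)
  then obtain \<rho> where \<rho>: "renaming \<rho>" "subst_atm \<rho> ?A0 = A"
    using mutual_instances_renaming \<gamma> by metis
  obtain ds' where ds': "sld_derivation F P [?B] ds' []" "answer ds' = subst_comp (answer ds) \<rho>"
    using refutation_rename_answer[OF ds(1) _ \<rho>(1)] by blast
  let ?\<theta> = "subst_restrict (vars_query [?B]) (answer ds')"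
  have "subst_atm ?\<theta> ?B = subst_atm (answer ds') ?B"
    unfolding subst_atm_eq_iff by (simp add: subst_restrict_def)
  also have "\<dots> = A"
    unfolding ds'(2) subst_atm_comp by (rule \<rho>(2))
  finally have "A = subst_atm ?\<theta> ?B" ..
  moreover have "computed_answer F P [?B] ?\<theta>"
    using ds'(1) by (auto simp: computed_answer_def answer_def)
  ultimately show ?thesis
    unfolding s_semantics_def using A(2) Vs by (intro CollectI exI[of _ p] exI[of _ Vs] exI[of _ ?\<theta>]) auto
qed

theorem theorem2:
  fixes F :: "('f \<times> nat) set" and Q :: "('p \<times> nat) set"
    and P :: "('p, 'f, 'v::infinite) clause set"
    and S :: "('p, 'f, 'v) atm set"
  assumes "finite P" and "P \<subseteq> clauses F Q"
    and "S \<subseteq> TB F Q"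
    and "\<exists>lev. level_mapping S lev \<and>
      (\<forall>A\<in>S. \<exists>C\<in>P. \<exists>As. set As \<subseteq> S \<and> A \<in> T_pi F {C} (set As) \<and>
        (\<forall>A'\<in>set As. lev A > lev A'))"
  shows "S \<subseteq> s_semantics F Q P"
proof
  obtain lev :: "('p, 'f, 'v) atm \<Rightarrow> nat" where lev: "\<forall>A\<in>S. \<exists>C\<in>P. \<exists>As. set As \<subseteq> S \<and> A \<in> T_pi F {C} (set As) \<and>
        (\<forall>A'\<in>set As. lev A > lev A')"
    using assms(4) by blast
  have resolvable: "resolvable F Q P [A]" if "A \<in> S" for A
    using that
  \<comment> \<open>No separate base case: for an atom of minimal level in \<open>S\<close> the list
    \<open>As\<close> is empty, which forces \<open>C\<close> to be a fact.\<close>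
  proof (induction A rule: measure_induct_rule[of lev])
    case (less A)
    obtain C As where C: "C \<in> P" "set As \<subseteq> S" "A \<in> T_pi F {C} (set As)"
        "\<forall>A'\<in>set As. lev A > lev A'"
      using bspec[OF lev less.prems] by (elim bexE exE conjE)
    show ?case
      by (rule resolvable_T_pi[OF assms(2) C(1,3)]) (use less.IH C(2,4) in blast)
  qed
  fix A assume "A \<in> S"
  then show "A \<in> s_semantics F Q P"
    using resolvable resolvable_in_s_semantics assms(3) by blast
qed

end
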